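(* Let $(X,D)$ be an $\mathcal{F}$-metric space with respect to $(f,\alpha)\in\mathcal{F}\times[0,\infty)$, and let $g:X\to X$ be a contraction in the setting of the $\mathcal{F}$-metric space, i.e. there exists $K\in(0,1)$ such that $D(g(x),g(y))\le K\,D(x,y)$ for all $x,y\in X$. Then there exists a metric $d$ on $X$ such that $g$ is a contraction with respect to $d$, i.e. there exists $K'\in(0,1)$ such that $d(g(x),g(y))\le K'\,d(x,y)$ for all $x,y\in X$.
   Context: Let $\mathcal{F}$ be the set of all functions $f:(0,\infty)\to\mathbb{R}$ satisfying: ($\mathcal{F}_1$) $f$ is non-decreasing, i.e. $0<s<t$ implies $f(s)\le f(t)$; ($\mathcal{F}_2$) for every sequence $\{t_n\}_{n\in\mathbb{N}}\subseteq(0,\infty)$, $\lim_{n\to\infty}t_n=0$ if and only if $\lim_{n\to\infty}f(t_n)=-\infty$. Let $X$ be a non-empty set, $D:X\times X\to[0,\infty)$ a mapping and $(f,\alpha)\in\mathcal{F}\times[0,\infty)$. The pair $(X,D)$ is an $\mathcal{F}$-metric space with respect to $(f,\alpha)$ (and $D$ is an $\mathcal{F}$-metric on $X$) if: (D1) for all $(x,y)\in X\times X$, $D(x,y)=0$ if and only if $x=y$; (D2) $D(x,y)=D(y,x)$ for all $(x,y)\in X\times X$; (D3) for every $(x,y)\in X\times X$, every $N\in\mathbb{N}$ with $N\ge 2$, and every $(u_i)_{i=1}^N\subseteq X$ with $(u_1,u_N)=(x,y)$: if $D(x,y)>0$, then $f(D(x,y))\le f\left(\sum_{i=1}^{N-1}D(u_i,u_{i+1})\right)+\alpha$.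 *)

theory Defs
  imports "HOL-Analysis.Analysis"
begin

text \<open>
  Functions \<open>f : (0,\<infinity>) \<rightarrow> \<real>\<close> are total functions on \<^typ>\<open>real\<close> of which only the values on
  \<open>{0<..}\<close> are constrained.
\<close>

definition F_class :: "(real \<Rightarrow> real) set" where
  "F_class = {f. mono_on {0<..} f \<and>
     (\<forall>t :: nat \<Rightarrow> real. (\<forall>n. t n > 0) \<longrightarrow>
        (t \<longlonglongrightarrow> 0 \<longleftrightarrow> filterlim (\<lambda>n. f (t n)) at_bot sequentially))}"

text \<open>
  The sum in \<open>chain\<close> is over \<open>i = 1, \<dots>, N - 1\<close>. When \<open>D x y > 0\<close> it is positive by \<open>eq_zero_iff\<close>,
  so \<open>f\<close> is only evaluated on its domain.
\<close>

locale F_metric_space =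
  fixes X :: "'a set" and D :: "'a \<Rightarrow> 'a \<Rightarrow> real" and f :: "real \<Rightarrow> real" and \<alpha> :: real
  assumes nonempty: "X \<noteq> {}"
    and f_in_class: "f \<in> F_class"
    and alpha_nonneg: "\<alpha> \<ge> 0"
    and nonneg: "\<lbrakk>x \<in> X; y \<in> X\<rbrakk> \<Longrightarrow> D x y \<ge> 0"
    and eq_zero_iff: "\<lbrakk>x \<in> X; y \<in> X\<rbrakk> \<Longrightarrow> D x y = 0 \<longleftrightarrow> x = y"
    and commute: "\<lbrakk>x \<in> X; y \<in> X\<rbrakk> \<Longrightarrow> D x y = D y x"
    and chain: "\<And>x y (N :: nat) (u :: nat \<Rightarrow> 'a).
      \<lbrakk>x \<in> X; y \<in> X; N \<ge> 2; \<forall>i\<in>{1..N}. u i \<in> X; u 1 = x; u N = y; D x y > 0\<rbrakk>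
      \<Longrightarrow> f (D x y) \<le> f (\<Sum>i = 1..<N. D (u i) (u (i + 1))) + \<alpha>"

definition contraction_map_on :: "'a set \<Rightarrow> ('a \<Rightarrow> 'a \<Rightarrow> real) \<Rightarrow> ('a \<Rightarrow> 'a) \<Rightarrow> bool" where
  "contraction_map_on X D g \<longleftrightarrow>
     (\<exists>K\<in>{0<..<1}. \<forall>x\<in>X. \<forall>y\<in>X. D (g x) (g y) \<le> K * D x y)"

end

theory Submission
  imports Defs
begin

text \<open>
  The metric is the infimum of the \<open>D\<close>-lengths of finite chains joining two points: the largest
  pseudometric on \<open>X\<close> below \<open>D\<close>. Chains can be concatenated and reversed, which gives the triangle
  inequality and symmetry. A map that shrinks \<open>D\<close> by a factor \<open>K\<close> shrinks the length of every
  chain by \<open>K\<close>, hence also the infimum, so \<open>g\<close> stays a contraction with the same constant.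

  Only the separation of points depends on \<open>f\<close> and \<open>\<alpha>\<close>. If distinct \<open>x\<close>, \<open>y\<close> were joined by
  chains of lengths \<open>s n \<longlonglongrightarrow> 0\<close>, then \<open>f (s n)\<close> would tend to minus infinity, while the chain
  inequality of an F-metric space bounds \<open>f (s n)\<close> from below by \<open>f (D x y) - \<alpha>\<close>
  (\<open>f_le_f_chain_length\<close>, \<open>chain_dist_pos\<close>).
\<close>

text \<open>
  Building chains by prepending points makes concatenation, reversal and transport along a map
  plain inductions; \<open>chain_length_as_sum\<close> recovers the indexed sums in
  the axiom of an F-metric space.
\<close>

inductive chain_length :: "'a set \<Rightarrow> ('a \<Rightarrow> 'a \<Rightarrow> real) \<Rightarrow> 'a \<Rightarrow> 'a \<Rightarrow> real \<Rightarrow> bool"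
  for X D where
  link: "\<lbrakk>x \<in> X; y \<in> X\<rbrakk> \<Longrightarrow> chain_length X D x y (D x y)"
| prepend: "\<lbrakk>x \<in> X; chain_length X D y z s\<rbrakk> \<Longrightarrow> chain_length X D x z (D x y + s)"

text \<open>
  Outside \<open>X\<close> there are no chains, and the infimum of the empty set is unspecified; the value \<open>0\<close>
  there keeps the function non-negative on the whole type, as \<^locale>\<open>Metric_space\<close> demands.
\<close>

definition chain_dist :: "'a set \<Rightarrow> ('a \<Rightarrow> 'a \<Rightarrow> real) \<Rightarrow> 'a \<Rightarrow> 'a \<Rightarrow> real" where
  "chain_dist X D x y = (if x \<in> X \<and> y \<in> X then Inf {s. chain_length X D x y s} else 0)"

lemma chain_length_in_space:
  "chain_length X D x y s \<Longrightarrow> x \<in> X \<and> y \<in> X"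
  by (induction rule: chain_length.induct) auto

lemma chain_length_append:
  assumes "chain_length X D x y s" "chain_length X D y z t"
  shows "chain_length X D x z (s + t)"
  using assms
proof (induction rule: chain_length.induct)
  case (link x y)
  then show ?case by (simp add: chain_length.prepend)
next
  case (prepend x w y s)
  then show ?case by (simp add: chain_length.prepend add.assoc)
qed

lemma chain_length_reverse:
  assumes comm: "\<And>x y. \<lbrakk>x \<in> X; y \<in> X\<rbrakk> \<Longrightarrow> D x y = D y x"
    and "chain_length X D x y s"
  shows "chain_length X D y x s"
  using assms(2)
proof (induction rule: chain_length.induct)
  case (link x y)
  then show ?case using chain_length.link[of y X x D] comm[of x y] by simp
next
  case (prepend x y z s)
  have y: "y \<in> X" using chain_length_in_space[OF prepend.hyps(2)] by simp
  have "chain_length X D y x (D x y)"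
    using chain_length.link[of y X x D] comm[of x y] prepend.hyps(1) y by simp
  from chain_length_append[OF prepend.IH this] show ?case by (simp add: add.commute)
qed

text \<open>
  The image of a chain under \<open>g\<close> is again a chain. Its length is estimated link by link, so the
  factor \<open>K\<close> survives summation whatever the number of links.
\<close>

lemma chain_length_image:
  assumes g: "g \<in> X \<rightarrow> X"
    and le: "\<And>x y. \<lbrakk>x \<in> X; y \<in> X\<rbrakk> \<Longrightarrow> D (g x) (g y) \<le> K * D x y"
    and "chain_length X D x y s"
  shows "\<exists>t \<le> K * s. chain_length X D (g x) (g y) t"
  using assms(3)
proof (induction rule: chain_length.induct)
  case (link x y)
  then have "chain_length X D (g x) (g y) (D (g x) (g y))"
    using g by (intro chain_length.link) auto
  then show ?case
    by (intro exI[of _ "D (g x) (g y)"] conjI le link)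
next
  case (prepend x y z s)
  obtain t where t: "t \<le> K * s" "chain_length X D (g y) (g z) t"
    using prepend.IH by auto
  have "y \<in> X" using chain_length_in_space[OF prepend.hyps(2)] by simp
  then have "D (g x) (g y) + t \<le> K * (D x y + s)"
    using le[of x y] prepend.hyps(1) t(1) by (simp add: distrib_left add_mono)
  moreover have "chain_length X D (g x) (g z) (D (g x) (g y) + t)"
    using g prepend.hyps(1) t(2) by (intro chain_length.prepend) auto
  ultimately show ?case by blast
qed

lemma chain_length_as_sum:
  assumes "chain_length X D x y s"
  shows "\<exists>(N::nat) u. N \<ge> 2 \<and> (\<forall>i\<in>{1..N}. u i \<in> X) \<and> u 1 = x \<and> u N = y \<and>
           s = (\<Sum>i = 1..<N. D (u i) (u (i + 1)))"
  using assms
proof (induction rule: chain_length.induct)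
  case (link x y)
  show ?case
    by (rule exI[of _ 2], rule exI[of _ "\<lambda>i. if i = 1 then x else y"])
       (use link in \<open>auto simp: numeral_2_eq_2\<close>)
next
  case (prepend x y z s)
  then obtain N :: nat and u where u: "N \<ge> 2" "\<forall>i\<in>{1..N}. u i \<in> X" "u 1 = y" "u N = z"
      "s = (\<Sum>i = 1..<N. D (u i) (u (i + 1)))" by blast
  define v where "v = (\<lambda>i. if i = 1 then x else u (i - 1))"
  have "(\<Sum>i = 1..<Suc N. D (v i) (v (i + 1))) =
        D (v 1) (v 2) + (\<Sum>i = Suc 1..<Suc N. D (v i) (v (i + 1)))"
    using u(1) by (subst sum.atLeast_Suc_lessThan) (auto simp: numeral_2_eq_2)
  also have "(\<Sum>i = Suc 1..<Suc N. D (v i) (v (i + 1))) = s"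
    unfolding sum.shift_bounds_Suc_ivl u(5) by (rule sum.cong) (auto simp: v_def)
  also have "D (v 1) (v 2) = D x y" using u(3) by (simp add: v_def)
  finally have sum: "D x y + s = (\<Sum>i = 1..<Suc N. D (v i) (v (i + 1)))" by simp
  have "v i \<in> X" if "i \<in> {1..Suc N}" for i
    using u(2) prepend.hyps(1) that by (cases i) (auto simp: v_def)
  moreover have "v 1 = x" "v (Suc N) = z" "Suc N \<ge> 2" using u(1,4) by (auto simp: v_def)
  ultimately show ?case using sum by blast
qed

lemma chain_length_nonneg:
  assumes "\<And>x y. \<lbrakk>x \<in> X; y \<in> X\<rbrakk> \<Longrightarrow> D x y \<ge> 0"
    and "chain_length X D x y s"
  shows "s \<ge> 0"
  using assms(2)
proof (induction rule: chain_length.induct)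
  case (prepend x y z s)
  then show ?case using assms(1)[of x y] chain_length_in_space[of X D y z s] by simp
qed (use assms(1) in blast)

lemma chain_dist_le:
  assumes "\<And>x y. \<lbrakk>x \<in> X; y \<in> X\<rbrakk> \<Longrightarrow> D x y \<ge> 0"
    and "chain_length X D x y s"
  shows "chain_dist X D x y \<le> s"
proof -
  have "bdd_below {s. chain_length X D x y s}"
    using chain_length_nonneg[of X D x y, OF assms(1)] by (auto intro!: bdd_belowI[of _ 0])
  then show ?thesis
    using assms(2) chain_length_in_space[OF assms(2)] by (simp add: chain_dist_def cInf_lower)
qed

lemma chain_dist_greatest:
  assumes "x \<in> X" "y \<in> X" "\<And>s. chain_length X D x y s \<Longrightarrow> b \<le> s"
  shows "b \<le> chain_dist X D x y"
  using assms chain_length.link[of x X y D] by (auto simp: chain_dist_def intro!: cInf_greatest)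

lemma chain_dist_triangle:
  assumes nonneg: "\<And>x y. \<lbrakk>x \<in> X; y \<in> X\<rbrakk> \<Longrightarrow> D x y \<ge> 0"
    and X: "x \<in> X" "y \<in> X" "z \<in> X"
  shows "chain_dist X D x z \<le> chain_dist X D x y + chain_dist X D y z"
proof -
  have "chain_dist X D x z - t \<le> chain_dist X D x y" if t: "chain_length X D y z t" for t
  proof (rule chain_dist_greatest[OF X(1,2)])
    fix s assume "chain_length X D x y s"
    from chain_dist_le[OF nonneg chain_length_append[OF this t]]
    show "chain_dist X D x z - t \<le> s" by simp
  qed
  then have "chain_dist X D x z - chain_dist X D x y \<le> t" if "chain_length X D y z t" for t
    using that by (simp add: algebra_simps)
  from chain_dist_greatest[of y X z D, OF X(2,3) this] show ?thesis by simp
qed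

lemma chain_dist_commute:
  assumes "\<And>x y. \<lbrakk>x \<in> X; y \<in> X\<rbrakk> \<Longrightarrow> D x y = D y x"
  shows "chain_dist X D x y = chain_dist X D y x"
proof -
  have "chain_length X D x y s \<longleftrightarrow> chain_length X D y x s" for s
    using chain_length_reverse[of X D, OF assms] by blast
  then have "{s. chain_length X D x y s} = {s. chain_length X D y x s}" by blast
  then show ?thesis by (simp only: chain_dist_def conj_commute)
qed

lemma chain_dist_contraction:
  assumes nonneg: "\<And>x y. \<lbrakk>x \<in> X; y \<in> X\<rbrakk> \<Longrightarrow> D x y \<ge> 0"
    and g: "g \<in> X \<rightarrow> X" and con: "contraction_map_on X D g"
  shows "contraction_map_on X (chain_dist X D) g"
proof -
  obtain K where K: "0 < K" "K < 1"
    and le: "\<And>x y. \<lbrakk>x \<in> X; y \<in> X\<rbrakk> \<Longrightarrow> D (g x) (g y) \<le> K * D x y"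
    using con by (auto simp: contraction_map_on_def)
  have "chain_dist X D (g x) (g y) \<le> K * chain_dist X D x y" if X: "x \<in> X" "y \<in> X" for x y
  proof -
    have "chain_dist X D (g x) (g y) / K \<le> chain_dist X D x y"
    proof (rule chain_dist_greatest[OF X])
      fix s assume "chain_length X D x y s"
      then obtain t where t: "t \<le> K * s" "chain_length X D (g x) (g y) t"
        using chain_length_image[of g X D K x y s] g le by blast
      from chain_dist_le[OF nonneg t(2)] t(1) show "chain_dist X D (g x) (g y) / K \<le> s"
        using K(1) by (simp add: divide_simps mult.commute)
    qed
    then show ?thesis using K(1) by (simp add: divide_simps mult.commute)
  qed
  then show ?thesis using K unfolding contraction_map_on_def by force
qed

context F_metric_space
begin

text \<open>
  Positivity puts the length into \<open>{0<..}\<close>, the only place where membership of \<open>f\<close> in \<^const>\<open>F_class\<close>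
  says anything about \<open>f\<close>.
\<close>

lemma chain_length_pos:
  assumes "chain_length X D x y s" "x \<noteq> y"
  shows "s > 0"
  using assms
proof (induction rule: chain_length.induct)
  case (link x y)
  then show ?case using nonneg[of x y] eq_zero_iff[of x y] by force
next
  case (prepend x y z s)
  have y: "y \<in> X" using chain_length_in_space[OF prepend.hyps(2)] by simp
  have "s \<ge> 0" using chain_length_nonneg[OF nonneg prepend.hyps(2)] .
  then show ?case
    using prepend nonneg[of x y] eq_zero_iff[of x y] y by (cases "x = y") force+
qed

lemma f_le_f_chain_length:
  assumes "chain_length X D x y s" "x \<noteq> y"
  shows "f (D x y) \<le> f s + \<alpha>"
proof -
  have X: "x \<in> X" "y \<in> X" using chain_length_in_space[OF assms(1)] by auto
  then have "D x y > 0" using nonneg[of x y] eq_zero_iff[of x y] assms(2) by force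
  moreover obtain N :: nat and u where "N \<ge> 2" "\<forall>i\<in>{1..N}. u i \<in> X" "u 1 = x" "u N = y"
    and s: "s = (\<Sum>i = 1..<N. D (u i) (u (i + 1)))"
    using chain_length_as_sum[OF assms(1)] by metis
  ultimately show ?thesis unfolding s using X by (intro chain)
qed

text \<open>
  A vanishing infimum would provide a sequence of chain lengths tending to \<open>0\<close>, along which \<open>f\<close>
  is unbounded below, against \<open>f_le_f_chain_length\<close>.
\<close>

lemma chain_dist_pos:
  assumes X: "x \<in> X" "y \<in> X" and "x \<noteq> y"
  shows "chain_dist X D x y > 0"
proof (rule ccontr)
  assume "\<not> chain_dist X D x y > 0"
  then have small: "\<exists>s. chain_length X D x y s \<and> s < e" if "e > 0" for e
    using chain_dist_greatest[OF X, of D e] that by force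
  have "\<forall>n. \<exists>s. chain_length X D x y s \<and> s < inverse (real (Suc n))"
    by (intro allI small) simp
  then obtain s where s: "\<And>n. chain_length X D x y (s n)" "\<And>n. s n < inverse (real (Suc n))"
    by metis
  have pos: "s n > 0" for n using chain_length_pos[OF s(1) \<open>x \<noteq> y\<close>] .
  have "s \<longlonglongrightarrow> 0"
    by (rule tendsto_sandwich[OF _ _ tendsto_const LIMSEQ_inverse_real_of_nat])
       (auto intro!: always_eventually less_imp_le pos s(2)[simplified])
  then have "filterlim (\<lambda>n. f (s n)) at_bot sequentially"
    using f_in_class pos by (auto simp: F_class_def)
  then have "eventually (\<lambda>n. f (s n) < f (D x y) - \<alpha>) sequentially"
    by (simp add: filterlim_at_bot_dense)
  then obtain n where "f (s n) < f (D x y) - \<alpha>"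
    by (auto simp: eventually_sequentially)
  then show False using f_le_f_chain_length[OF s(1)[of n] \<open>x \<noteq> y\<close>] by simp
qed

lemma Metric_space_chain_dist: "Metric_space X (chain_dist X D)"
proof
  show nonneg_dist: "0 \<le> chain_dist X D x y" for x y
  proof (cases "x \<in> X \<and> y \<in> X")
    case True
    show ?thesis
      by (rule chain_dist_greatest[OF _ _ chain_length_nonneg[OF nonneg]]) (use True in auto)
  qed (auto simp: chain_dist_def)
  show "chain_dist X D x y = chain_dist X D y x" for x y
    using commute by (rule chain_dist_commute)
  show "chain_dist X D x y = 0 \<longleftrightarrow> x = y" if X: "x \<in> X" "y \<in> X" for x y
  proof
    show "x = y" if "chain_dist X D x y = 0"
      using chain_dist_pos[OF X] that by force
    show "chain_dist X D x y = 0" if "x = y"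
      using chain_dist_le[of X D x y, OF nonneg chain_length.link[OF X]] nonneg_dist[of x y]
        eq_zero_iff[OF X] that by simp
  qed
  show "chain_dist X D x z \<le> chain_dist X D x y + chain_dist X D y z"
    if "x \<in> X" "y \<in> X" "z \<in> X" for x y z
    using nonneg that by (rule chain_dist_triangle)
qed

end

theorem theorem2p4:
  fixes X :: "'a set" and D :: "'a \<Rightarrow> 'a \<Rightarrow> real"
    and f :: "real \<Rightarrow> real" and \<alpha> :: real and g :: "'a \<Rightarrow> 'a"
  assumes "F_metric_space X D f \<alpha>"
    and "g \<in> X \<rightarrow> X"
    and "contraction_map_on X D g"
  shows "\<exists>d :: 'a \<Rightarrow> 'a \<Rightarrow> real. Metric_space X d \<and> contraction_map_on X d g"
proof -
  interpret F_metric_space X D f \<alpha> by fact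
  show ?thesis
    using Metric_space_chain_dist chain_dist_contraction[OF nonneg assms(2,3)] by blast
qed

end
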